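(* Let $M=(\mathbb{C}^* )^n\times U$ with $U\subset\mathbb{C}^m$ open and convex, let $\rho$ be a $T$-invariant strictly plurisubharmonic function on $M$, $\omega=\sqrt{-1}\,\partial\bar\partial\rho$, and let $h$ be the Ricci potential of $\omega$. Then the Ricci potential $h_\lambda$ of the reduced K\"ahler form $\omega_\lambda$ is $$h_\lambda=\iota_\lambda^*\left(h+\log\det\left(\frac{\partial^2\rho}{\partial z_i\,\partial\bar z_j}\right)\right).$$
   Context: $T=(S^1)^n$ acts on $M=(\mathbb{C}^* )^n\times U$ by multiplication on $(\mathbb{C}^* )^n$; $z_1,\dots,z_n$ and $w_1,\dots,w_m$ are the coordinates on $(\mathbb{C}^* )^n$ and $U$. A $T$-invariant function is a (smooth) function of $|z_1|^2,\dots,|z_n|^2$ and $w$. The moment map is $\Phi=(\phi_1,\dots,\phi_n)$, $\phi_j=z_j\,\partial\rho/\partial z_j$. For $\lambda\in\mathbb{R}^n$, $\iota_\lambda$ is the inclusion of $\Phi^{-1}(\lambda)$ in $M$; the projection $M\to U$ restricted to $\Phi^{-1}(\lambda)$ identifies $M_\lambda=\Phi^{-1}(\lambda)/T$ locally with $U$, and via this $w_1,\dots,w_m$ are local holomorphic coordinates on $M_\lambda$; $\iota_\lambda^*u$, for a $T$-invariant function $u$, is regarded as a function of $w$. $\omega_\lambda=\sqrt{-1}\sum\psi_{\alpha,\bar\beta}\,dw_\alpha\wedge d\bar w_\beta$ is the reduced K\"ahler form on $M_\lambda$ (its pull-back to $\Phi^{-1}(\lambda)$ is $\iota_\lambda^*\omega$).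 Ricci potentials: the Ricci potential $h$ of $\omega=\sqrt{-1}\,\partial\bar\partial\rho$ is minus the logarithm of the determinant of the full $(n+m)\times(n+m)$ complex Hessian matrix of $\rho$ in the coordinates $(z,w)$, and the Ricci potential $h_\lambda$ of $\omega_\lambda$ is $-\log\det(\psi_{\alpha,\bar\beta})$. The determinant in the formula is that of the $n\times n$ block of $z$-derivatives. *)

theory Defs
  imports "HOL-Analysis.Analysis"
begin

section \<open>Smooth functions\<close>

text \<open>
  \<open>f\<close> is of class $C^k$ on the open set \<open>S\<close>: all iterated directional derivatives up to
  order \<open>k\<close> exist (as Frechet differentiable functions) and are continuous.
\<close>

primrec Ck_on :: "nat \<Rightarrow> ('a::euclidean_space \<Rightarrow> 'b::real_normed_vector) \<Rightarrow> 'a set \<Rightarrow> bool" where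
  "Ck_on 0 f S \<longleftrightarrow> continuous_on S f"
| "Ck_on (Suc k) f S \<longleftrightarrow>
     (\<forall>x\<in>S. f differentiable (at x)) \<and>
     (\<forall>v. Ck_on k (\<lambda>x. frechet_derivative f (at x) v) S)"

definition smooth_on :: "('a::euclidean_space \<Rightarrow> 'b::real_normed_vector) \<Rightarrow> 'a set \<Rightarrow> bool" where
  "smooth_on f S \<longleftrightarrow> (\<forall>k. Ck_on k f S)"

section \<open>Coordinates and Wirtinger derivatives\<close>

text \<open>
  A point is a pair \<open>(z, w)\<close>. The full list of coordinates $(z_1,\dots,z_n,w_1,\dots,w_m)$ is
  indexed by the sum type \<open>'n + 'm\<close>: \<open>Inl i\<close> stands for $z_i$ and \<open>Inr \<alpha>\<close> for $w_\alpha$.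
\<close>

definition phase_space :: "(complex ^ 'm) set \<Rightarrow> ((complex ^ 'n) \<times> (complex ^ 'm)) set" where
  "phase_space U = {(z, w). (\<forall>i. z $ i \<noteq> 0) \<and> w \<in> U}"

definition coords :: "(complex ^ 'n) \<times> (complex ^ 'm) \<Rightarrow> complex ^ ('n + 'm)" where
  "coords p = (\<chi> k. case k of Inl i \<Rightarrow> fst p $ i | Inr a \<Rightarrow> snd p $ a)"

definition coord_vec :: "'n + 'm \<Rightarrow> complex \<Rightarrow> (complex ^ 'n) \<times> (complex ^ 'm)" where
  "coord_vec k c = (case k of Inl i \<Rightarrow> (axis i c, 0) | Inr a \<Rightarrow> (0, axis a c))"

text \<open>
  With $u_k = x_k + \sqrt{-1}\,y_k$:
  $\partial/\partial u_k = \frac12(\partial/\partial x_k - \sqrt{-1}\,\partial/\partial y_k)$ and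
  $\partial/\partial \bar u_k = \frac12(\partial/\partial x_k + \sqrt{-1}\,\partial/\partial y_k)$.
\<close>

definition d_hol ::
  "'n + 'm \<Rightarrow> ((complex ^ 'n) \<times> (complex ^ 'm) \<Rightarrow> complex) \<Rightarrow> (complex ^ 'n) \<times> (complex ^ 'm) \<Rightarrow> complex"
  where
  "d_hol k f p =
     (frechet_derivative f (at p) (coord_vec k 1)
        - \<i> * frechet_derivative f (at p) (coord_vec k \<i>)) / 2"

definition d_antihol ::
  "'n + 'm \<Rightarrow> ((complex ^ 'n) \<times> (complex ^ 'm) \<Rightarrow> complex) \<Rightarrow> (complex ^ 'n) \<times> (complex ^ 'm) \<Rightarrow> complex"
  where
  "d_antihol k f p =
     (frechet_derivative f (at p) (coord_vec k 1)
        + \<i> * frechet_derivative f (at p) (coord_vec k \<i>)) / 2"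

section \<open>Complex Hessian and associated (1,1)-form\<close>

definition complex_hessian ::
  "((complex ^ 'n) \<times> (complex ^ 'm) \<Rightarrow> real) \<Rightarrow> (complex ^ 'n) \<times> (complex ^ 'm)
     \<Rightarrow> complex ^ ('n + 'm) ^ ('n + 'm)"
  where
  "complex_hessian \<rho> p =
     (\<chi> k l. d_hol k (d_antihol l (\<lambda>q. complex_of_real (\<rho> q))) p)"

definition z_hessian ::
  "((complex ^ 'n) \<times> (complex ^ 'm) \<Rightarrow> real) \<Rightarrow> (complex ^ 'n) \<times> (complex ^ 'm)
     \<Rightarrow> complex ^ 'n ^ 'n"
  where
  "z_hessian \<rho> p =
     (\<chi> i j. d_hol (Inl i) (d_antihol (Inl j) (\<lambda>q. complex_of_real (\<rho> q))) p)"

definition strictly_plurisubharmonic_on ::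
  "((complex ^ 'n) \<times> (complex ^ 'm) \<Rightarrow> real) \<Rightarrow> ((complex ^ 'n) \<times> (complex ^ 'm)) set \<Rightarrow> bool"
  where
  "strictly_plurisubharmonic_on \<rho> M \<longleftrightarrow>
     (\<forall>p\<in>M. \<forall>v. v \<noteq> 0 \<longrightarrow>
        Re (\<Sum>k\<in>UNIV. \<Sum>l\<in>UNIV. complex_hessian \<rho> p $ k $ l * v $ k * cnj (v $ l)) > 0)"

text \<open>
  Value on a pair of real tangent vectors of the form
  $\sqrt{-1}\sum_{k,l} H_{k\bar l}\,du_k\wedge d\bar u_l$, where
  $(du_k\wedge d\bar u_l)(X,Y) = X_k\overline{Y_l} - Y_k\overline{X_l}$.
\<close>

definition form11 :: "complex ^ 'k ^ 'k \<Rightarrow> complex ^ 'k \<Rightarrow> complex ^ 'k \<Rightarrow> complex" where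
  "form11 H X Y =
     \<i> * (\<Sum>k\<in>UNIV. \<Sum>l\<in>UNIV. H $ k $ l * (X $ k * cnj (Y $ l) - Y $ k * cnj (X $ l)))"

text \<open>$\omega = \sqrt{-1}\,\partial\bar\partial\rho$\<close>

definition kaehler_form ::
  "((complex ^ 'n) \<times> (complex ^ 'm) \<Rightarrow> real) \<Rightarrow> (complex ^ 'n) \<times> (complex ^ 'm)
     \<Rightarrow> (complex ^ 'n) \<times> (complex ^ 'm) \<Rightarrow> (complex ^ 'n) \<times> (complex ^ 'm) \<Rightarrow> complex"
  where
  "kaehler_form \<rho> p X Y = form11 (complex_hessian \<rho> p) (coords X) (coords Y)"

section \<open>Torus action, moment map, reduced space\<close>

definition torus :: "(complex ^ 'n) set" where
  "torus = {t. \<forall>i. norm (t $ i) = 1}"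

definition torus_act ::
  "complex ^ 'n \<Rightarrow> (complex ^ 'n) \<times> (complex ^ 'm) \<Rightarrow> (complex ^ 'n) \<times> (complex ^ 'm)" where
  "torus_act t p = (\<chi> i. t $ i * fst p $ i, snd p)"

definition torus_orbit ::
  "(complex ^ 'n) \<times> (complex ^ 'm) \<Rightarrow> ((complex ^ 'n) \<times> (complex ^ 'm)) set" where
  "torus_orbit p = (\<lambda>t. torus_act t p) ` torus"

definition torus_invariant_on ::
  "((complex ^ 'n) \<times> (complex ^ 'm) \<Rightarrow> 'a) \<Rightarrow> ((complex ^ 'n) \<times> (complex ^ 'm)) set \<Rightarrow> bool"
  where
  "torus_invariant_on u M \<longleftrightarrow> (\<forall>t\<in>torus. \<forall>p\<in>M. u (torus_act t p) = u p)"

text \<open>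
  $\phi_j = z_j\,\partial\rho/\partial z_j$; for torus invariant \<open>\<rho>\<close> it is real valued, so the
  level sets over real vectors \<open>\<mu>\<close> are all that matter.
\<close>

definition moment_map ::
  "((complex ^ 'n) \<times> (complex ^ 'm) \<Rightarrow> real) \<Rightarrow> (complex ^ 'n) \<times> (complex ^ 'm) \<Rightarrow> complex ^ 'n"
  where
  "moment_map \<rho> p = (\<chi> j. fst p $ j * d_hol (Inl j) (\<lambda>q. complex_of_real (\<rho> q)) p)"

definition moment_level ::
  "((complex ^ 'n) \<times> (complex ^ 'm) \<Rightarrow> real) \<Rightarrow> (complex ^ 'm) set \<Rightarrow> real ^ 'n
     \<Rightarrow> ((complex ^ 'n) \<times> (complex ^ 'm)) set"
  where
  "moment_level \<rho> U \<mu> =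
     {p \<in> phase_space U. \<forall>j. moment_map \<rho> p $ j = complex_of_real (\<mu> $ j)}"

text \<open>
  The action is free, so every value of the moment map is regular and the tangent space of its
  level set at \<open>p\<close> is the kernel of the differential.
\<close>

definition level_tangent ::
  "((complex ^ 'n) \<times> (complex ^ 'm) \<Rightarrow> real) \<Rightarrow> (complex ^ 'n) \<times> (complex ^ 'm)
     \<Rightarrow> ((complex ^ 'n) \<times> (complex ^ 'm)) set"
  where
  "level_tangent \<rho> p = {X. frechet_derivative (moment_map \<rho>) (at p) X = 0}"

text \<open>
  Points of $M_\mu = \Phi^{-1}(\mu)/T$ are the orbits in the level set.
\<close>

definition reduced_space ::
  "((complex ^ 'n) \<times> (complex ^ 'm) \<Rightarrow> real) \<Rightarrow> (complex ^ 'm) set \<Rightarrow> real ^ 'n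
     \<Rightarrow> ((complex ^ 'n) \<times> (complex ^ 'm)) set set"
  where
  "reduced_space \<rho> U \<mu> = torus_orbit ` moment_level \<rho> U \<mu>"

text \<open>
  \<open>\<psi>\<close> gives, at each point of the reduced space, the coefficients in the coordinates \<open>w\<close> of
  the reduced form $\omega_\mu = \sqrt{-1}\sum\psi_{\alpha\bar\beta}\,dw_\alpha\wedge d\bar w_\beta$.
  It is characterised by its pull-back to the level set being $\iota_\mu^*\omega$. Since \<open>w\<close> is
  torus invariant, the pull-back of $dw_\alpha$ to the level set sends \<open>X\<close> to \<open>snd X $ \<alpha>\<close>.
\<close>

definition reduced_form_coeffs ::
  "((complex ^ 'n) \<times> (complex ^ 'm) \<Rightarrow> real) \<Rightarrow> (complex ^ 'm) set \<Rightarrow> real ^ 'n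
     \<Rightarrow> (((complex ^ 'n) \<times> (complex ^ 'm)) set \<Rightarrow> complex ^ 'm ^ 'm) \<Rightarrow> bool"
  where
  "reduced_form_coeffs \<rho> U \<mu> \<psi> \<longleftrightarrow>
     (\<forall>Q\<in>reduced_space \<rho> U \<mu>. \<forall>p\<in>Q. \<forall>X\<in>level_tangent \<rho> p. \<forall>Y\<in>level_tangent \<rho> p.
        form11 (\<psi> Q) (snd X) (snd Y) = kaehler_form \<rho> p X Y)"

section \<open>Ricci potentials\<close>

text \<open>
  Applied to Hermitian positive definite matrices only, whose determinant is a positive real;
  \<open>Re\<close> merely changes its type.
\<close>

definition log_det :: "complex ^ 'k ^ 'k \<Rightarrow> real" where
  "log_det H = ln (Re (det H))"

definition ricci_potential ::
  "((complex ^ 'n) \<times> (complex ^ 'm) \<Rightarrow> real) \<Rightarrow> (complex ^ 'n) \<times> (complex ^ 'm) \<Rightarrow> real" where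
  "ricci_potential \<rho> p = - log_det (complex_hessian \<rho> p)"

definition reduced_ricci_potential ::
  "(((complex ^ 'n) \<times> (complex ^ 'm)) set \<Rightarrow> complex ^ 'm ^ 'm)
     \<Rightarrow> ((complex ^ 'n) \<times> (complex ^ 'm)) set \<Rightarrow> real" where
  "reduced_ricci_potential \<psi> Q = - log_det (\<psi> Q)"

end

theory Submission
  imports Defs
begin

text \<open>
  Fix a point \<open>p\<close> of the level set and split the complex Hessian \<open>H\<close> of \<open>\<rho>\<close> at \<open>p\<close> into the
  blocks \<open>A\<close> (derivatives in $z$, $\bar z$), \<open>B\<close> ($z$, $\bar w$), \<open>C\<close> ($w$, $\bar z$) and
  \<open>D\<close> ($w$, $\bar w$). The matrix of the reduced form is the Schur complement
  $S = D - C A^{-1} B$, and the factorisation $\det H = \det A \cdot \det S$ becomes the formula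
  for the Ricci potentials after taking logarithms.

  That $\psi = S$ comes from horizontal lifts. Since the moment map is real valued, its
  differential is determined by its $\bar\partial$-part, and $\bar\partial\phi_j$ is $z_j$ times row
  \<open>j\<close> of $(A\; B)$. So a vector annihilated by these rows is tangent to the level set
  (\<open>level_tangent_memI\<close>), and each vector $\xi$ in the $w$-directions has a lift
  $(-\overline{A^{-1}B}\,\xi, \xi)$ with this property. On such lifts the rows of \<open>H\<close>
  belonging to $z$ contribute nothing to $\omega$ and the rows belonging to $w$ reduce to \<open>S\<close>
  (\<open>form11_horizontal_lift\<close>); as a $(1,1)$-form determines its coefficients
  (\<open>form11_inject\<close>), the defining property of $\psi$ gives the claim.

  Two analytic facts enter. Torus invariance makes $z_j\,\partial\rho/\partial z_j$ real
  (\<open>moment_map_real\<close>). The symmetry of second derivatives (\<open>second_derivative_symmetric\<close>)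
  identifies $\bar\partial_l\partial_j\rho$ with $\partial_j\bar\partial_l\rho$ and makes \<open>H\<close>
  Hermitian; together with strict plurisubharmonicity this makes $\det H$ and $\det A$
  nonzero real numbers.
\<close>

section \<open>Block determinants\<close>

lemma sum_UNIV_Plus:
  fixes g :: "'a::finite + 'b::finite \<Rightarrow> 'c::comm_monoid_add"
  shows "(\<Sum>k\<in>UNIV. g k) = (\<Sum>i\<in>UNIV. g (Inl i)) + (\<Sum>a\<in>UNIV. g (Inr a))"
  by (simp add: sum.Plus flip: UNIV_Plus_UNIV)

text \<open>
  A triangular block matrix whose other diagonal block is the identity. Only the permutations
  that fix every index outside \<open>range f\<close> contribute to the Leibniz sum, and these
  are the images of the permutations of the smaller index type. Stating it for an arbitrary
  injection \<open>f\<close> covers both positions of the nontrivial block in a sum type.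
\<close>

lemma det_embedded_block:
  fixes A :: "'a::comm_ring_1 ^ 'k ^ 'k" and M :: "'a ^ 'l ^ 'l" and f :: "'k \<Rightarrow> 'l"
  assumes f: "inj f"
    and block: "\<And>i j. M $ f i $ f j = A $ i $ j"
    and zero: "\<And>i l. l \<notin> range f \<Longrightarrow> M $ f i $ l = 0"
    and one: "\<And>k l. k \<notin> range f \<Longrightarrow> l \<notin> range f \<Longrightarrow> M $ k $ l = (if k = l then 1 else 0)"
  shows "det M = det A"
proof -
  let ?P = "{p. p permutes (UNIV :: 'k set)}" and ?E = "map_permutation UNIV f"
  have inj: "inj_on ?E ?P"
  proof (rule inj_onI)
    fix p q assume "?E p = ?E q"
    then have "f (p i) = f (q i)" for i
      using map_permutation_apply[OF f, of i] by (metis UNIV_I)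
    then show "p = q" using f by (auto simp: inj_def)
  qed
  have perm: "?E q permutes UNIV" if "q permutes UNIV" for q
    using that f by (metis bij_betw_imageI map_permutation_permutes permutes_subset subset_UNIV)
  have vanish: "(\<Prod>k\<in>UNIV. M $ k $ p k) = 0" if "p permutes UNIV" "p \<notin> ?E ` ?P" for p
  proof (rule ccontr)
    assume "(\<Prod>k\<in>UNIV. M $ k $ p k) \<noteq> 0"
    then have nz: "M $ k $ p k \<noteq> 0" for k
      by (metis (mono_tags, lifting) UNIV_I finite_class.finite_UNIV prod_zero)
    \<comment> \<open>The zero entries force \<open>p\<close> to preserve \<open>range f\<close>, hence its complement, where the
      identity entries leave only fixed points.\<close>
    have "p ` range f \<subseteq> range f"
      using nz zero by blast
    then have img: "p ` range f = range f"
      by (meson endo_inj_surj finite_imageI finite_class.finite_UNIV inj_on_subset permutes_inj subset_UNIV that(1))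
    have "p k = k" if "k \<notin> range f" for k
    proof -
      have "p k \<notin> range f"
        using img that permutes_inj[OF \<open>p permutes UNIV\<close>] by (metis image_iff inj_image_mem_iff)
      then show ?thesis using one[OF that] nz[of k] by metis
    qed
    then have "p permutes range f"
      using permutes_superset[OF that(1)] by blast
    moreover have "f ((inv f) x) = x" if "x \<in> range f" for x
      using that by (simp add: f_inv_into_f)
    ultimately have "?E (map_permutation (range f) (inv f) p) = p"
      using f by (intro map_permutation_compose_inv[of _ "range f"])
        (auto intro!: bij_betw_imageI inj_on_inv_into)
    moreover have "map_permutation (range f) (inv f) p permutes UNIV"
      using f \<open>p permutes range f\<close>
      by (auto intro!: map_permutation_permutes bij_betw_imageI inj_on_inv_into)
    ultimately show False using that(2) by (metis image_eqI mem_Collect_eq)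
  qed
  have "det M = (\<Sum>p\<in>?E ` ?P. of_int (sign p) * (\<Prod>k\<in>UNIV. M $ k $ p k))"
    unfolding det_def using perm vanish by (intro sum.mono_neutral_right) auto
  also have "\<dots> = (\<Sum>q\<in>?P. of_int (sign (?E q)) * (\<Prod>k\<in>UNIV. M $ k $ ?E q k))"
    by (simp add: sum.reindex[OF inj])
  also have "\<dots> = det A"
    unfolding det_def
  proof (rule sum.cong)
    fix q assume "q \<in> ?P"
    then have "sign (?E q) = sign q"
      using f by (simp add: sign_map_permutation)
    moreover have "(\<Prod>k\<in>UNIV. M $ k $ ?E q k) = (\<Prod>k\<in>range f. M $ k $ ?E q k)"
      by (rule prod.mono_neutral_right) (auto simp: map_permutation_def one)
    moreover have "\<dots> = (\<Prod>i\<in>UNIV. A $ i $ q i)"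
      using f by (simp add: prod.reindex map_permutation_apply block)
    ultimately show "of_int (sign (?E q)) * (\<Prod>k\<in>UNIV. M $ k $ ?E q k)
        = of_int (sign q) * (\<Prod>i\<in>UNIV. A $ i $ q i)" by simp
  qed simp
  finally show ?thesis .
qed

text \<open>
  The matrix \<open>X\<close> stands for $A^{-1}B$; keeping it as a parameter, tied to the blocks of \<open>H\<close> only
  by $A X = B$, avoids matrix inverses.
\<close>

definition schur_complement ::
  "'a::comm_ring_1 ^ ('n::finite + 'm::finite) ^ ('n + 'm) \<Rightarrow> 'a ^ 'm ^ 'n \<Rightarrow> 'a ^ 'm ^ 'm" where
  "schur_complement H X =
     (\<chi> a b. H $ Inr a $ Inr b - (\<Sum>j\<in>UNIV. H $ Inr a $ Inl j * X $ j $ b))"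

text \<open>
  The equations $A X = B$ and $C X + S = D$ say that \<open>H\<close> is the product of the matrix with
  rows $(A, 0)$, $(C, 1)$ and the matrix with rows $(1, X)$, $(0, S)$.
\<close>

lemma det_schur_complement:
  fixes H :: "'a::comm_ring_1 ^ ('n::finite + 'm::finite) ^ ('n + 'm)" and A :: "'a ^ 'n ^ 'n"
  assumes A: "\<And>i j. A $ i $ j = H $ Inl i $ Inl j"
    and X: "\<And>i b. (\<Sum>j\<in>UNIV. A $ i $ j * X $ j $ b) = H $ Inl i $ Inr b"
  shows "det H = det A * det (schur_complement H X)"
proof -
  let ?S = "schur_complement H X"
  define L :: "'a ^ ('n + 'm) ^ ('n + 'm)" where
    "L = (\<chi> k l. case l of Inl j \<Rightarrow> H $ k $ Inl j | Inr b \<Rightarrow> (if k = Inr b then 1 else 0))"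
  define R :: "'a ^ ('n + 'm) ^ ('n + 'm)" where
    "R = (\<chi> k l. case k of
            Inl i \<Rightarrow> (case l of Inl j \<Rightarrow> (if i = j then 1 else 0) | Inr b \<Rightarrow> X $ i $ b)
          | Inr a \<Rightarrow> (case l of Inl j \<Rightarrow> 0 | Inr b \<Rightarrow> ?S $ a $ b))"
  have "(L ** R) $ k $ l = H $ k $ l" for k l
    by (cases k; cases l)
      (simp_all add: matrix_matrix_mult_def L_def R_def sum_UNIV_Plus schur_complement_def
        if_distrib[of "\<lambda>x. _ * x"] if_distrib[of "\<lambda>x. x * _"] X flip: A cong: if_cong)
  then have "det H = det L * det R"
    by (metis det_mul vec_eq_iff)
  moreover have "det L = det A"
    by (rule det_embedded_block[of Inl]) (auto simp: L_def A split: sum.split)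
  moreover have "det R = det ?S"
    by (rule det_embedded_block[of Inr]) (auto simp: R_def split: sum.split)
  ultimately show ?thesis by simp
qed

text \<open>
  A kernel vector \<open>v\<close> would make the form vanish at its conjugate, since
  the form pairs \<open>H\<close> with the conjugate in its column argument.
\<close>

lemma positive_definite_det_nonzero:
  fixes H :: "complex ^ 'k ^ 'k"
  assumes "\<And>v. v \<noteq> 0 \<Longrightarrow> Re (\<Sum>k\<in>UNIV. \<Sum>l\<in>UNIV. H $ k $ l * v $ k * cnj (v $ l)) > 0"
  shows "det H \<noteq> 0"
proof -
  have "v = 0" if "H *v v = 0" for v
  proof (rule ccontr)
    let ?c = "\<chi> k. cnj (v $ k)"
    assume "v \<noteq> 0"
    then obtain k where "v $ k \<noteq> 0" by (metis vec_eq_iff zero_index)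
    then have "?c $ k \<noteq> 0 $ k" by simp
    then have "?c \<noteq> 0" by metis
    moreover have "(\<Sum>k\<in>UNIV. \<Sum>l\<in>UNIV. H $ k $ l * ?c $ k * cnj (?c $ l))
        = (\<Sum>k\<in>UNIV. cnj (v $ k) * (H *v v) $ k)"
      by (simp add: matrix_vector_mult_def sum_distrib_left mult_ac)
    ultimately show False using assms[of ?c] that by simp
  qed
  then show ?thesis
    by (metis invertible_det_nz invertible_left_inverse matrix_left_invertible_ker)
qed

lemma hermitian_det_real:
  fixes H :: "complex ^ 'k ^ 'k"
  assumes "\<And>k l. cnj (H $ k $ l) = H $ l $ k"
  shows "Im (det H) = 0"
proof -
  have "cnj (det H) = det (transpose H)"
    unfolding det_def by (simp add: assms transpose_def)
  then show ?thesis
    by (metis det_transpose Reals_cnj_iff complex_is_Real_iff)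
qed

text \<open>
  Inserting \<open>axis a c\<close> and \<open>axis b 1\<close> with \<open>c = 1\<close> and
  \<open>c = \<i>\<close> recovers $P_{ab} - P_{ba}$ and $P_{ab} + P_{ba}$.
\<close>

lemma form11_inject:
  assumes "\<And>X Y. form11 P X Y = form11 S X Y"
  shows "P = S"
proof -
  have form_axis: "form11 Q (axis a c) (axis b 1) = \<i> * (Q $ a $ b * c - Q $ b $ a * cnj c)"
    for Q :: "complex ^ 'k ^ 'k" and a b c
  proof -
    have "(\<Sum>k\<in>UNIV. \<Sum>l\<in>UNIV. Q $ k $ l * (axis a c $ k * cnj (axis b 1 $ l))) = Q $ a $ b * c"
         "(\<Sum>k\<in>UNIV. \<Sum>l\<in>UNIV. Q $ k $ l * (axis b 1 $ k * cnj (axis a c $ l))) = Q $ b $ a * cnj c"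
      by (simp_all add: axis_def if_distrib[of "\<lambda>x. _ * x"] if_distrib[of "\<lambda>x. x * _"]
          if_distrib[of cnj] cong: if_cong)
    then show ?thesis by (simp add: form11_def right_diff_distrib sum_subtractf)
  qed
  have "P $ a $ b = S $ a $ b" for a b
  proof -
    have "P $ a $ b - P $ b $ a = S $ a $ b - S $ b $ a"
      using assms[of "axis a 1" "axis b 1"] by (simp add: form_axis)
    moreover have "\<i> * (P $ a $ b + P $ b $ a) = \<i> * (S $ a $ b + S $ b $ a)"
      using assms[of "axis a \<i>" "axis b 1"] by (simp add: form_axis algebra_simps)
    ultimately show ?thesis by simp algebra
  qed
  then show ?thesis by (simp add: vec_eq_iff)
qed

section \<open>Symmetry of second derivatives\<close>

text \<open>The derivative is first taken in direction \<open>v\<close>, then in direction \<open>u\<close>.\<close>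

definition second_derivative ::
  "('a::euclidean_space \<Rightarrow> real) \<Rightarrow> 'a \<Rightarrow> 'a \<Rightarrow> 'a \<Rightarrow> real" where
  "second_derivative f p u v = frechet_derivative (\<lambda>x. frechet_derivative f (at x) v) (at p) u"

lemma smooth_on_differentiable:
  assumes "smooth_on f S" "x \<in> S"
  shows "f differentiable (at x)"
proof -
  have "Ck_on (Suc 0) f S" using assms by (auto simp: smooth_on_def)
  then show ?thesis using assms by simp
qed

lemma smooth_on_frechet_derivative:
  assumes "smooth_on f S"
  shows "smooth_on (\<lambda>x. frechet_derivative f (at x) v) S"
proof -
  have "Ck_on (Suc k) f S" for k using assms by (auto simp: smooth_on_def)
  then show ?thesis by (simp add: smooth_on_def)
qed

lemma smooth_on_continuous: "smooth_on f S \<Longrightarrow> continuous_on S f"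
  unfolding smooth_on_def by (metis Ck_on.simps(1))

lemma has_real_derivative_along_line:
  fixes f :: "'a::euclidean_space \<Rightarrow> real"
  assumes "f differentiable (at (c + s *\<^sub>R u))"
  shows "((\<lambda>t. f (c + t *\<^sub>R u)) has_real_derivative frechet_derivative f (at (c + s *\<^sub>R u)) u) (at s)"
proof -
  have D: "(f has_derivative frechet_derivative f (at (c + s *\<^sub>R u))) (at (c + s *\<^sub>R u))"
    using assms frechet_derivative_works by blast
  have "((\<lambda>t. c + t *\<^sub>R u) has_derivative (\<lambda>t. t *\<^sub>R u)) (at s)"
    by (auto intro!: derivative_eq_intros)
  from has_derivative_compose[OF this D] show ?thesis
    using linear_frechet_derivative[OF assms]
    by (auto simp: has_field_derivative_def linear_scale mult.commute elim!: has_derivative_eq_rhs)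
qed

text \<open>
  Apply the mean value theorem to $s \mapsto f(p+su+hv) - f(p+su)$, and then in direction \<open>v\<close> to
  the derivative of \<open>f\<close> along \<open>u\<close>. The difference on the left-hand side is unchanged when \<open>u\<close> and
  \<open>v\<close> trade places, which is what makes second derivatives symmetric.
\<close>

lemma second_difference_mean_value:
  fixes f :: "'a::euclidean_space \<Rightarrow> real"
  assumes f: "smooth_on f S" and h: "0 < h"
    and inS: "\<And>s t. 0 \<le> s \<Longrightarrow> s \<le> h \<Longrightarrow> 0 \<le> t \<Longrightarrow> t \<le> h \<Longrightarrow> p + s *\<^sub>R u + t *\<^sub>R v \<in> S"
  obtains s t where "0 < s" "s < h" "0 < t" "t < h"
    "f (p + h *\<^sub>R u + h *\<^sub>R v) - f (p + h *\<^sub>R u) - (f (p + h *\<^sub>R v) - f p)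
       = h * (h * second_derivative f (p + s *\<^sub>R u + t *\<^sub>R v) v u)"
proof -
  let ?g = "\<lambda>x. frechet_derivative f (at x) u"
  have inS0: "p + s *\<^sub>R u \<in> S" if "0 \<le> s" "s \<le> h" for s
    using inS[of s 0] that h by simp
  have "((\<lambda>s. f (p + s *\<^sub>R u + h *\<^sub>R v) - f (p + s *\<^sub>R u)) has_real_derivative
      ?g (p + s *\<^sub>R u + h *\<^sub>R v) - ?g (p + s *\<^sub>R u)) (at s)"
    if "0 \<le> s" "s \<le> h" for s
  proof (rule DERIV_diff)
    show "((\<lambda>s. f (p + s *\<^sub>R u + h *\<^sub>R v)) has_real_derivative ?g (p + s *\<^sub>R u + h *\<^sub>R v)) (at s)"
      using has_real_derivative_along_line[of f "p + h *\<^sub>R v" s u]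
        smooth_on_differentiable[OF f inS[of s h]] that h by (simp add: add_ac)
    show "((\<lambda>s. f (p + s *\<^sub>R u)) has_real_derivative ?g (p + s *\<^sub>R u)) (at s)"
      using has_real_derivative_along_line smooth_on_differentiable[OF f inS0] that by blast
  qed
  from MVT2[OF h this] obtain s where s: "0 < s" "s < h"
    and eq1: "f (p + h *\<^sub>R u + h *\<^sub>R v) - f (p + h *\<^sub>R u) - (f (p + h *\<^sub>R v) - f p)
      = h * (?g (p + s *\<^sub>R u + h *\<^sub>R v) - ?g (p + s *\<^sub>R u))"
    by auto
  have "((\<lambda>t. ?g (p + s *\<^sub>R u + t *\<^sub>R v)) has_real_derivative
      second_derivative f (p + s *\<^sub>R u + t *\<^sub>R v) v u) (at t)"
    if "0 \<le> t" "t \<le> h" for t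
    unfolding second_derivative_def using that s
    by (intro has_real_derivative_along_line
        smooth_on_differentiable[OF smooth_on_frechet_derivative[OF f]] inS) auto
  from MVT2[OF h this] obtain t where t: "0 < t" "t < h"
    and "?g (p + s *\<^sub>R u + h *\<^sub>R v) - ?g (p + s *\<^sub>R u)
      = h * second_derivative f (p + s *\<^sub>R u + t *\<^sub>R v) v u"
    by auto
  with eq1 s that show ?thesis by metis
qed

text \<open>
  The two ways of evaluating the second difference over a small parallelogram yield values of
  the two mixed derivatives at points of that parallelogram; these agree, and by continuity
  they are close to the mixed derivatives at \<open>p\<close>.
\<close>

lemma second_derivative_symmetric:
  fixes f :: "'a::euclidean_space \<Rightarrow> real"
  assumes S: "open S" and f: "smooth_on f S" and p: "p \<in> S"
  shows "second_derivative f p u v = second_derivative f p v u"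
proof -
  have cont: "isCont (\<lambda>x. second_derivative f x u v) p" for u v
    unfolding second_derivative_def
    using S f p smooth_on_continuous smooth_on_frechet_derivative continuous_on_eq_continuous_at
    by blast
  have "\<bar>second_derivative f p u v - second_derivative f p v u\<bar> \<le> e" if "0 < e" for e
  proof -
    have ev: "\<forall>\<^sub>F x in nhds p. dist (second_derivative f x u v) (second_derivative f p u v) < e / 2" for u v
      using tendsto_at_iff_tendsto_nhds[THEN iffD1, OF cont[of u v, unfolded isCont_def]] that
      by (intro tendstoD) auto
    have "\<forall>\<^sub>F x in nhds p. x \<in> S \<and> dist (second_derivative f x u v) (second_derivative f p u v) < e / 2
        \<and> dist (second_derivative f x v u) (second_derivative f p v u) < e / 2"
      using ev[of u v] ev[of v u] S p
      by (intro eventually_conj eventually_nhds_in_open)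
    then obtain d where d: "0 < d" and near: "\<And>x. dist x p < d \<Longrightarrow> x \<in> S
        \<and> dist (second_derivative f x u v) (second_derivative f p u v) < e / 2
        \<and> dist (second_derivative f x v u) (second_derivative f p v u) < e / 2"
      unfolding eventually_nhds_metric by blast
    \<comment> \<open>Small enough for the parallelogram spanned by \<open>h *\<^sub>R u\<close> and \<open>h *\<^sub>R v\<close> to stay within
      distance \<open>d\<close> of \<open>p\<close>; the summand \<open>1\<close> takes care of \<open>u = v = 0\<close>.\<close>
    define h where "h = d / (norm u + norm v + 1)"
    have pos: "0 < norm u + norm v + 1"
      by (metis add.commute add_le_less_mono add_nonneg_nonneg add_0 norm_ge_zero zero_less_one)
    then have h: "0 < h" using d by (simp add: h_def)
    have close: "dist (p + s *\<^sub>R u + t *\<^sub>R v) p < d" if "0 \<le> s" "s \<le> h" "0 \<le> t" "t \<le> h" for s t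
    proof -
      have "dist (p + s *\<^sub>R u + t *\<^sub>R v) p \<le> s * norm u + t * norm v"
        using that norm_triangle_ineq[of "s *\<^sub>R u" "t *\<^sub>R v"] by (simp add: dist_norm add.assoc)
      also have "\<dots> \<le> h * norm u + h * norm v"
        using that by (intro add_mono mult_right_mono) auto
      also have "\<dots> < h * (norm u + norm v + 1)"
        using h by (simp add: algebra_simps)
      also have "\<dots> = d" using pos by (simp add: h_def)
      finally show ?thesis .
    qed
    obtain s t where st: "0 < s" "s < h" "0 < t" "t < h"
      and eq1: "f (p + h *\<^sub>R u + h *\<^sub>R v) - f (p + h *\<^sub>R u) - (f (p + h *\<^sub>R v) - f p)
       = h * (h * second_derivative f (p + s *\<^sub>R u + t *\<^sub>R v) v u)"
      using second_difference_mean_value[OF f h, of p u v] close near by metis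
    have close': "p + s *\<^sub>R v + t *\<^sub>R u \<in> S" if "0 \<le> s" "s \<le> h" "0 \<le> t" "t \<le> h" for s t
      using close[of t s] near that by (simp add: add_ac)
    obtain s' t' where st': "0 < s'" "s' < h" "0 < t'" "t' < h"
      and eq2: "f (p + h *\<^sub>R v + h *\<^sub>R u) - f (p + h *\<^sub>R v) - (f (p + h *\<^sub>R u) - f p)
       = h * (h * second_derivative f (p + s' *\<^sub>R v + t' *\<^sub>R u) u v)"
      using second_difference_mean_value[OF f h, of p v u] close' by metis
    have swap: "p + h *\<^sub>R v + h *\<^sub>R u = p + h *\<^sub>R u + h *\<^sub>R v" by (simp add: add_ac)
    have "h * (h * second_derivative f (p + s *\<^sub>R u + t *\<^sub>R v) v u)
        = h * (h * second_derivative f (p + s' *\<^sub>R v + t' *\<^sub>R u) u v)"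
      using eq1 eq2[unfolded swap] by linarith
    then have eq: "second_derivative f (p + s *\<^sub>R u + t *\<^sub>R v) v u
        = second_derivative f (p + t' *\<^sub>R u + s' *\<^sub>R v) u v"
      using h by (simp add: add_ac)
    have "\<bar>second_derivative f (p + s *\<^sub>R u + t *\<^sub>R v) v u - second_derivative f p v u\<bar> < e / 2"
      using near[OF close[of s t]] st by (simp add: dist_real_def)
    moreover have "\<bar>second_derivative f (p + t' *\<^sub>R u + s' *\<^sub>R v) u v - second_derivative f p u v\<bar> < e / 2"
      using near[OF close[of t' s']] st' by (simp add: dist_real_def)
    ultimately show ?thesis using eq by linarith
  qed
  then have "\<bar>second_derivative f p u v - second_derivative f p v u\<bar> \<le> 0"
    by (rule dense_ge)
  then show ?thesis by simp
qed

section \<open>The complex Hessian in real coordinates\<close>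

lemma coord_vec_linear: "linear (coord_vec k)"
  by (cases k; intro linearI) (auto simp: coord_vec_def axis_def vec_eq_iff)

lemma frechet_derivative_complex_of_real:
  assumes "f differentiable (at x)"
  shows "frechet_derivative (\<lambda>q. complex_of_real (f q)) (at x)
    = (\<lambda>v. complex_of_real (frechet_derivative f (at x) v))"
  using assms unfolding frechet_derivative_works
  by (intro frechet_derivative_at[symmetric] has_derivative_of_real)

context
  fixes \<rho> :: "(complex ^ 'n) \<times> (complex ^ 'm) \<Rightarrow> real"
    and S :: "((complex ^ 'n) \<times> (complex ^ 'm)) set"
    and p :: "(complex ^ 'n) \<times> (complex ^ 'm)"
  assumes S: "open S" and smooth: "smooth_on \<rho> S" and p: "p \<in> S"
begin

lemma has_derivative_frechet_derivative:
  "((\<lambda>q. frechet_derivative \<rho> (at q) v) has_derivative (\<lambda>u. second_derivative \<rho> p u v)) (at p)"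
  using smooth_on_differentiable[OF smooth_on_frechet_derivative[OF smooth] p]
  by (simp add: frechet_derivative_works second_derivative_def)

lemma has_derivative_d_antihol:
  "(d_antihol l (\<lambda>q. complex_of_real (\<rho> q)) has_derivative
     (\<lambda>u. (complex_of_real (second_derivative \<rho> p u (coord_vec l 1))
           + \<i> * complex_of_real (second_derivative \<rho> p u (coord_vec l \<i>))) / 2)) (at p)"
  by (rule has_derivative_transform_within_open[OF _ S p,
        where f = "\<lambda>q. (complex_of_real (frechet_derivative \<rho> (at q) (coord_vec l 1))
           + \<i> * complex_of_real (frechet_derivative \<rho> (at q) (coord_vec l \<i>))) / 2"])
    (auto intro!: derivative_eq_intros has_derivative_frechet_derivative
      simp: d_antihol_def frechet_derivative_complex_of_real smooth_on_differentiable[OF smooth])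

lemma has_derivative_d_hol:
  "(d_hol l (\<lambda>q. complex_of_real (\<rho> q)) has_derivative
     (\<lambda>u. (complex_of_real (second_derivative \<rho> p u (coord_vec l 1))
           - \<i> * complex_of_real (second_derivative \<rho> p u (coord_vec l \<i>))) / 2)) (at p)"
  by (rule has_derivative_transform_within_open[OF _ S p,
        where f = "\<lambda>q. (complex_of_real (frechet_derivative \<rho> (at q) (coord_vec l 1))
           - \<i> * complex_of_real (frechet_derivative \<rho> (at q) (coord_vec l \<i>))) / 2"])
    (auto intro!: derivative_eq_intros has_derivative_frechet_derivative
      simp: d_hol_def frechet_derivative_complex_of_real smooth_on_differentiable[OF smooth])

lemma complex_hessian_entry:
  "complex_hessian \<rho> p $ k $ l =
     Complex (second_derivative \<rho> p (coord_vec k 1) (coord_vec l 1)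
                + second_derivative \<rho> p (coord_vec k \<i>) (coord_vec l \<i>))
             (second_derivative \<rho> p (coord_vec k 1) (coord_vec l \<i>)
                - second_derivative \<rho> p (coord_vec k \<i>) (coord_vec l 1)) / 4"
  unfolding complex_hessian_def
  by (simp add: d_hol_def[of k] frechet_derivative_at[OF has_derivative_d_antihol, symmetric]
      complex_eq_iff field_simps)

lemma complex_hessian_hermitian:
  "cnj (complex_hessian \<rho> p $ k $ l) = complex_hessian \<rho> p $ l $ k"
  by (simp add: complex_hessian_entry complex_eq_iff second_derivative_symmetric[OF S smooth p])

end

section \<open>The differential of the moment map\<close>

lemma open_phase_space:
  fixes U :: "(complex ^ 'm) set"
  assumes "open U"
  shows "open (phase_space U :: ((complex ^ 'n) \<times> (complex ^ 'm)) set)"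
proof -
  have "phase_space U = (\<Inter>i. {p :: (complex ^ 'n) \<times> (complex ^ 'm). fst p $ i \<noteq> 0}) \<inter> snd -` U"
    by (auto simp: phase_space_def)
  moreover have "open {p :: (complex ^ 'n) \<times> (complex ^ 'm). fst p $ i \<noteq> 0}" for i
    by (intro open_Collect_neq continuous_intros)
  ultimately show ?thesis
    using assms by (auto intro!: open_Int open_INT open_vimage_snd)
qed

text \<open>
  The imaginary part of $z_j\,\partial\rho/\partial z_j$ is $-\frac12$ times the derivative of
  \<open>\<rho>\<close> along the rotation of the \<open>j\<close>-th coordinate.
\<close>

lemma moment_map_real:
  fixes U :: "(complex ^ 'm) set" and \<rho> :: "(complex ^ 'n) \<times> (complex ^ 'm) \<Rightarrow> real"
  assumes smooth: "smooth_on \<rho> (phase_space U)"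
    and inv: "torus_invariant_on \<rho> (phase_space U)"
    and p: "p \<in> phase_space U"
  shows "Im (moment_map \<rho> p $ j) = 0"
proof -
  let ?z = "fst p $ j" and ?D = "frechet_derivative \<rho> (at p)"
  define \<gamma> where "\<gamma> \<theta> = p + coord_vec (Inl j) ((cis \<theta> - 1) * ?z)" for \<theta>
  have diff: "\<rho> differentiable (at p)"
    using smooth_on_differentiable[OF smooth p] .
  have lin: "linear ?D" by (rule linear_frechet_derivative[OF diff])
  have "\<gamma> \<theta> = torus_act (\<chi> k. if k = j then cis \<theta> else 1) p" for \<theta>
    by (auto simp: \<gamma>_def torus_act_def coord_vec_def prod_eq_iff vec_eq_iff axis_def algebra_simps)
  moreover have "(\<chi> k. if k = j then cis \<theta> else 1) \<in> torus" for \<theta>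
    by (simp add: torus_def)
  ultimately have const: "\<rho> (\<gamma> \<theta>) = \<rho> p" for \<theta>
    using inv p by (auto simp: torus_invariant_on_def)
  have "((\<lambda>\<theta>. (cis \<theta> - 1) * ?z) has_derivative (\<lambda>\<theta>. \<theta> *\<^sub>R (\<i> * ?z))) (at 0)"
    by (auto intro!: derivative_eq_intros simp: scaleR_conv_of_real)
  then have "(\<gamma> has_derivative (\<lambda>\<theta>. coord_vec (Inl j) (\<theta> *\<^sub>R (\<i> * ?z)))) (at 0)"
    unfolding \<gamma>_def
    by (auto intro!: derivative_eq_intros
        bounded_linear.has_derivative[OF coord_vec_linear[unfolded linear_conv_bounded_linear]])
  moreover have "(\<rho> has_derivative ?D) (at (\<gamma> 0))"
    using diff by (simp add: \<gamma>_def linear_0[OF coord_vec_linear] frechet_derivative_works)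
  ultimately have "((\<lambda>\<theta>. \<rho> (\<gamma> \<theta>)) has_derivative (\<lambda>\<theta>. ?D (coord_vec (Inl j) (\<theta> *\<^sub>R (\<i> * ?z))))) (at 0)"
    by (rule has_derivative_compose)
  then have "((\<lambda>\<theta>::real. \<rho> p) has_derivative (\<lambda>\<theta>. ?D (coord_vec (Inl j) (\<theta> *\<^sub>R (\<i> * ?z))))) (at 0)"
    by (simp add: const)
  then have "(\<lambda>\<theta>::real. ?D (coord_vec (Inl j) (\<theta> *\<^sub>R (\<i> * ?z)))) = (\<lambda>_. 0)"
    by (intro has_derivative_unique[OF _ has_derivative_const])
  then have "?D (coord_vec (Inl j) (1 *\<^sub>R (\<i> * ?z))) = 0" by metis
  moreover have "1 *\<^sub>R (\<i> * ?z) = (- Im ?z) *\<^sub>R 1 + Re ?z *\<^sub>R \<i>"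
    by (simp add: complex_eq_iff)
  ultimately have "- Im ?z * ?D (coord_vec (Inl j) 1) + Re ?z * ?D (coord_vec (Inl j) \<i>) = 0"
    by (simp only: linear_add[OF coord_vec_linear] linear_scale[OF coord_vec_linear]
        linear_add[OF lin] linear_scale[OF lin] real_scaleR_def)
  then show ?thesis
    by (simp add: moment_map_def d_hol_def frechet_derivative_complex_of_real[OF diff])
qed

lemma coords_expansion:
  "X = (\<Sum>k\<in>UNIV. Re (coords X $ k) *\<^sub>R coord_vec k 1 + Im (coords X $ k) *\<^sub>R coord_vec k \<i>)"
proof -
  have *: "Re c *\<^sub>R coord_vec k 1 + Im c *\<^sub>R coord_vec k \<i> = coord_vec k c" for k :: "'a + 'b" and c
  proof -
    have "c = Re c *\<^sub>R 1 + Im c *\<^sub>R \<i>" by (simp add: complex_eq_iff)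
    then show ?thesis
      by (metis linear_add[OF coord_vec_linear] linear_scale[OF coord_vec_linear])
  qed
  show ?thesis
    unfolding *
    by (simp add: sum_UNIV_Plus coords_def coord_vec_def prod_eq_iff fst_sum snd_sum vec_eq_iff axis_def)
qed

text \<open>
  A real-valued differential is twice the real part of its antiholomorphic part:
  $L(\partial_{x_k}) + \sqrt{-1}\,L(\partial_{y_k}) = 2\,\bar\partial_k$, which is paired with
  the conjugates of the coordinates.
\<close>

lemma real_valued_linear_coords:
  fixes L :: "(complex ^ 'n) \<times> (complex ^ 'm) \<Rightarrow> complex"
  assumes lin: "linear L" and real: "\<And>X. Im (L X) = 0"
  shows "L X = complex_of_real (Re (\<Sum>k\<in>UNIV. (L (coord_vec k 1) + \<i> * L (coord_vec k \<i>)) * cnj (coords X $ k)))"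
proof -
  have "L X = L (\<Sum>k\<in>UNIV. Re (coords X $ k) *\<^sub>R coord_vec k 1 + Im (coords X $ k) *\<^sub>R coord_vec k \<i>)"
    using coords_expansion[of X] by simp
  also have "\<dots> = (\<Sum>k\<in>UNIV. Re (coords X $ k) *\<^sub>R L (coord_vec k 1) + Im (coords X $ k) *\<^sub>R L (coord_vec k \<i>))"
    by (simp add: linear_sum[OF lin] linear_add[OF lin] linear_scale[OF lin])
  finally show ?thesis
    by (simp add: complex_eq_iff real mult_ac)
qed

lemma has_derivative_vec:
  fixes f :: "'a::real_normed_vector \<Rightarrow> 'b::euclidean_space ^ 'n"
  assumes "\<And>i. ((\<lambda>x. f x $ i) has_derivative (\<lambda>x. f' x $ i)) (at p)"
  shows "(f has_derivative f') (at p)"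
  using assms
  by (subst has_derivative_componentwise_within)
    (auto simp: Basis_vec_def inner_axis intro!: has_derivative_inner_left)

text \<open>
  The function $z_j$ is holomorphic, so
  $\bar\partial_l\phi_j = z_j\,\bar\partial_l\partial_j\rho = z_j H_{j\bar l}$, and because
  $\phi_j$ is real its differential at \<open>X\<close> is
  $2\,\mathrm{Re}\,(z_j \sum_l H_{j\bar l}\overline{X_l})$.
\<close>

lemma level_tangent_memI:
  fixes U :: "(complex ^ 'm) set" and \<rho> :: "(complex ^ 'n) \<times> (complex ^ 'm) \<Rightarrow> real"
  assumes U: "open U" and smooth: "smooth_on \<rho> (phase_space U)"
    and inv: "torus_invariant_on \<rho> (phase_space U)"
    and p: "p \<in> phase_space U"
    and X: "\<And>j. (\<Sum>l\<in>UNIV. complex_hessian \<rho> p $ Inl j $ l * cnj (coords X $ l)) = 0"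
  shows "X \<in> level_tangent \<rho> p"
proof -
  note S = open_phase_space[OF U]
  let ?h = "\<lambda>j. d_hol (Inl j) (\<lambda>q. complex_of_real (\<rho> q)) p"
  let ?D = "second_derivative \<rho> p"
  define L where "L j Y = fst p $ j * ((complex_of_real (?D Y (coord_vec (Inl j) 1))
      - \<i> * complex_of_real (?D Y (coord_vec (Inl j) \<i>))) / 2) + fst Y $ j * ?h j" for j Y
  have comp: "((\<lambda>q. moment_map \<rho> q $ j) has_derivative L j) (at p)" for j
    unfolding moment_map_def L_def vec_lambda_beta
    by (intro has_derivative_mult has_derivative_d_hol[OF S smooth p]
        bounded_linear_imp_has_derivative bounded_linear_compose[OF bounded_linear_vec_nth bounded_linear_fst])
  have "L j X = 0" for j
  proof -
    have lin: "linear (L j)" using comp has_derivative_linear by blast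
    have "((\<lambda>q. Im (moment_map \<rho> q $ j)) has_derivative (\<lambda>Y. Im (L j Y))) (at p)"
      using comp by (rule has_derivative_Im)
    moreover have "((\<lambda>q. Im (moment_map \<rho> q $ j)) has_derivative (\<lambda>Y. 0)) (at p)"
      using moment_map_real[OF smooth inv]
      by (intro has_derivative_transform_within_open[OF has_derivative_const[of 0] S p]) simp
    ultimately have real: "Im (L j Y) = 0" for Y
      using has_derivative_unique by metis
    have "L j (coord_vec l 1) + \<i> * L j (coord_vec l \<i>)
        = 2 * fst p $ j * complex_hessian \<rho> p $ Inl j $ l" for l
    proof -
      \<comment> \<open>Holomorphicity of $z_j$: the terms coming from its derivative cancel.\<close>
      have "fst (coord_vec l \<i> :: (complex ^ 'n) \<times> (complex ^ 'm)) $ j = \<i> * fst (coord_vec l 1 :: (complex ^ 'n) \<times> (complex ^ 'm)) $ j"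
        by (simp add: coord_vec_def axis_def split: sum.split)
      then show ?thesis
        by (simp add: L_def complex_hessian_entry[OF S smooth p] Complex_eq
            second_derivative_symmetric[OF S smooth p, of "coord_vec l _"] field_simps)
    qed
    then have "L j X = complex_of_real (Re (2 * fst p $ j *
        (\<Sum>l\<in>UNIV. complex_hessian \<rho> p $ Inl j $ l * cnj (coords X $ l))))"
      by (subst real_valued_linear_coords[OF lin real]) (simp add: sum_distrib_left mult.assoc)
    then show ?thesis by (simp add: X)
  qed
  moreover have "frechet_derivative (moment_map \<rho>) (at p) = (\<lambda>Y. \<chi> j. L j Y)"
    using comp by (intro frechet_derivative_at[symmetric] has_derivative_vec) simp
  ultimately show ?thesis
    by (simp add: level_tangent_def vec_eq_iff)
qed

section \<open>Horizontal lifts\<close>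

text \<open>
  With $A X = B$, the $z$-component \<open>\<eta>\<close> of the lift is the solution of
  $A \bar\eta + B \bar\xi = 0$.
\<close>

definition horizontal_lift :: "complex ^ 'm ^ 'n \<Rightarrow> complex ^ 'm \<Rightarrow> (complex ^ 'n) \<times> (complex ^ 'm)" where
  "horizontal_lift X \<xi> = (\<chi> j. - (\<Sum>b\<in>UNIV. cnj (X $ j $ b) * \<xi> $ b), \<xi>)"

lemma hessian_horizontal_lift:
  fixes H :: "complex ^ ('n::finite + 'm::finite) ^ ('n + 'm)"
  assumes X: "\<And>i b. (\<Sum>j\<in>UNIV. H $ Inl i $ Inl j * X $ j $ b) = H $ Inl i $ Inr b"
  shows "(\<Sum>l\<in>UNIV. H $ Inl i $ l * cnj (coords (horizontal_lift X \<xi>) $ l)) = 0"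
    and "(\<Sum>l\<in>UNIV. H $ Inr a $ l * cnj (coords (horizontal_lift X \<xi>) $ l))
      = (\<Sum>b\<in>UNIV. schur_complement H X $ a $ b * cnj (\<xi> $ b))"
proof -
  have row: "(\<Sum>l\<in>UNIV. H $ k $ l * cnj (coords (horizontal_lift X \<xi>) $ l))
      = (\<Sum>b\<in>UNIV. (H $ k $ Inr b - (\<Sum>j\<in>UNIV. H $ k $ Inl j * X $ j $ b)) * cnj (\<xi> $ b))" for k
  proof -
    have "(\<Sum>j\<in>UNIV. H $ k $ Inl j * (\<Sum>b\<in>UNIV. X $ j $ b * cnj (\<xi> $ b)))
        = (\<Sum>b\<in>UNIV. (\<Sum>j\<in>UNIV. H $ k $ Inl j * X $ j $ b) * cnj (\<xi> $ b))"
      by (simp add: sum_distrib_left sum_distrib_right mult.assoc sum.swap[of _ "UNIV :: 'n set"])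
    then show ?thesis
      by (simp add: sum_UNIV_Plus coords_def horizontal_lift_def sum_negf left_diff_distrib sum_subtractf)
  qed
  show "(\<Sum>l\<in>UNIV. H $ Inl i $ l * cnj (coords (horizontal_lift X \<xi>) $ l)) = 0"
    by (simp add: row X)
  show "(\<Sum>l\<in>UNIV. H $ Inr a $ l * cnj (coords (horizontal_lift X \<xi>) $ l))
      = (\<Sum>b\<in>UNIV. schur_complement H X $ a $ b * cnj (\<xi> $ b))"
    by (simp add: row schur_complement_def)
qed

lemma form11_rows:
  "form11 H X Y = \<i> * ((\<Sum>k\<in>UNIV. X $ k * (\<Sum>l\<in>UNIV. H $ k $ l * cnj (Y $ l)))
                     - (\<Sum>k\<in>UNIV. Y $ k * (\<Sum>l\<in>UNIV. H $ k $ l * cnj (X $ l))))"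
  by (simp add: form11_def sum_distrib_left right_diff_distrib sum_subtractf mult_ac)

text \<open>
  By the two row identities above, the sums over the rows of \<open>H\<close> lose their $z$-part, and
  in the $w$-part the lift has the coordinates of \<open>\<xi>\<close> and the row of \<open>H\<close> acts as the row of the
  Schur complement.
\<close>

lemma form11_horizontal_lift:
  fixes H :: "complex ^ ('n::finite + 'm::finite) ^ ('n + 'm)"
  assumes X: "\<And>i b. (\<Sum>j\<in>UNIV. H $ Inl i $ Inl j * X $ j $ b) = H $ Inl i $ Inr b"
  shows "form11 H (coords (horizontal_lift X \<xi>)) (coords (horizontal_lift X \<zeta>))
    = form11 (schur_complement H X) \<xi> \<zeta>"
proof -
  have "(\<Sum>k\<in>UNIV. coords (horizontal_lift X \<xi>) $ k *
          (\<Sum>l\<in>UNIV. H $ k $ l * cnj (coords (horizontal_lift X \<zeta>) $ l)))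
      = (\<Sum>a\<in>UNIV. \<xi> $ a * (\<Sum>b\<in>UNIV. schur_complement H X $ a $ b * cnj (\<zeta> $ b)))" for \<xi> \<zeta>
    unfolding sum_UNIV_Plus[of "\<lambda>k. coords (horizontal_lift X \<xi>) $ k *
          (\<Sum>l\<in>UNIV. H $ k $ l * cnj (coords (horizontal_lift X \<zeta>) $ l))"]
      hessian_horizontal_lift[OF X]
    by (simp add: coords_def horizontal_lift_def)
  then show ?thesis by (simp only: form11_rows)
qed

section \<open>The reduced Ricci potential\<close>

theorem theorem6p1:
  fixes U :: "(complex ^ 'm) set"
    and \<rho> :: "(complex ^ 'n) \<times> (complex ^ 'm) \<Rightarrow> real"
    and \<mu> :: "real ^ 'n"
    and \<psi> :: "((complex ^ 'n) \<times> (complex ^ 'm)) set \<Rightarrow> complex ^ 'm ^ 'm"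
  assumes "open U" and "convex U"
    and "smooth_on \<rho> (phase_space U)"
    and "torus_invariant_on \<rho> (phase_space U)"
    and "strictly_plurisubharmonic_on \<rho> (phase_space U)"
    and "reduced_form_coeffs \<rho> U \<mu> \<psi>"
  shows "\<forall>p\<in>moment_level \<rho> U \<mu>.
           reduced_ricci_potential \<psi> (torus_orbit p)
             = ricci_potential \<rho> p + log_det (z_hessian \<rho> p)"
proof
  fix p assume level: "p \<in> moment_level \<rho> U \<mu>"
  then have p: "p \<in> phase_space U" by (simp add: moment_level_def)
  let ?H = "complex_hessian \<rho> p" and ?A = "z_hessian \<rho> p"
  have block: "?A $ i $ j = ?H $ Inl i $ Inl j" for i j
    by (simp add: z_hessian_def complex_hessian_def)
  have posH: "Re (\<Sum>k\<in>UNIV. \<Sum>l\<in>UNIV. ?H $ k $ l * v $ k * cnj (v $ l)) > 0" if "v \<noteq> 0" for v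
    using assms(5) p that by (simp add: strictly_plurisubharmonic_on_def)
  have posA: "Re (\<Sum>i\<in>UNIV. \<Sum>j\<in>UNIV. ?A $ i $ j * v $ i * cnj (v $ j)) > 0" if v: "v \<noteq> 0" for v
  proof -
    let ?v = "\<chi> k. case k of Inl i \<Rightarrow> v $ i | Inr a \<Rightarrow> 0"
    obtain i where "v $ i \<noteq> 0" using v by (metis vec_eq_iff zero_index)
    then have "?v $ Inl i \<noteq> 0 $ Inl i" by simp
    then have "?v \<noteq> 0" by metis
    from posH[OF this] show ?thesis by (simp add: sum_UNIV_Plus block)
  qed
  note hermitian = complex_hessian_hermitian[OF open_phase_space[OF assms(1)] assms(3) p]
  have detH: "det ?H \<noteq> 0" "Im (det ?H) = 0"
    using positive_definite_det_nonzero[OF posH] hermitian_det_real[OF hermitian] by blast+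
  have "cnj (?A $ i $ j) = ?A $ j $ i" for i j
    unfolding block by (rule hermitian)
  then have detA: "det ?A \<noteq> 0" "Im (det ?A) = 0"
    using positive_definite_det_nonzero[OF posA] hermitian_det_real by blast+
  obtain A' where A': "?A ** A' = mat 1"
    using detA by (metis invertible_det_nz invertible_right_inverse)
  define X where "X = A' ** (\<chi> i b. ?H $ Inl i $ Inr b)"
  have "?A ** X = (\<chi> i b. ?H $ Inl i $ Inr b)"
    by (simp add: X_def matrix_mul_assoc A')
  then have X: "(\<Sum>j\<in>UNIV. ?A $ i $ j * X $ j $ b) = ?H $ Inl i $ Inr b" for i b
    by (simp add: matrix_matrix_mult_def vec_eq_iff)
  note X' = X[unfolded block]
  let ?S = "schur_complement ?H X"
  have orbit: "p \<in> torus_orbit p"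
    unfolding torus_orbit_def
    by (rule image_eqI[of _ _ "\<chi> i. 1"]) (simp_all add: torus_act_def torus_def prod_eq_iff vec_eq_iff)
  have tangent: "horizontal_lift X \<xi> \<in> level_tangent \<rho> p" for \<xi>
    using assms(1,3,4) p by (rule level_tangent_memI) (rule hessian_horizontal_lift(1)[OF X'])
  have "\<psi> (torus_orbit p) = ?S"
  proof (rule form11_inject)
    fix \<xi> \<zeta>
    have "form11 (\<psi> (torus_orbit p)) (snd (horizontal_lift X \<xi>)) (snd (horizontal_lift X \<zeta>))
        = kaehler_form \<rho> p (horizontal_lift X \<xi>) (horizontal_lift X \<zeta>)"
      using assms(6) level orbit tangent unfolding reduced_form_coeffs_def reduced_space_def by blast
    then show "form11 (\<psi> (torus_orbit p)) \<xi> \<zeta> = form11 ?S \<xi> \<zeta>"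
      unfolding kaehler_form_def form11_horizontal_lift[OF X']
      by (simp add: horizontal_lift_def)
  qed
  moreover have "det ?H = det ?A * det ?S"
    using block X by (rule det_schur_complement)
  then have "Re (det ?H) = Re (det ?A) * Re (det ?S)"
    using detA by simp
  moreover have "Re (det ?H) \<noteq> 0"
    using detH by (simp add: complex_eq_iff)
  \<comment> \<open>The real logarithm satisfies \<open>ln (- x) = ln x\<close>, so it turns products of nonzero factors into
    sums; their signs do not matter.\<close>
  ultimately show "reduced_ricci_potential \<psi> (torus_orbit p) = ricci_potential \<rho> p + log_det ?A"
    by (simp add: reduced_ricci_potential_def ricci_potential_def log_det_def ln_mult)
qed

end
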